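(* Let $n \ge 1$. The (deterministic) fragile complexity of finding the minimum of $n$ elements is exactly $\lceil \log_2 n \rceil$. That is: (i) there is a deterministic comparison-based algorithm that finds the minimum of any $n$ elements in which every element participates in at most $\lceil \log_2 n\rceil$ comparisons; and (ii) for every deterministic comparison-based algorithm that finds the minimum of $n$ elements, there is an input on which the minimum element participates in at least $\lceil \log_2 n\rceil$ comparisons.
   Context: Inputs are elements of a totally ordered set, accessed only through pairwise comparisons. A comparison-based algorithm has fragile complexity $f(n)$ if on every input of size $n$ each individual input element participates in at most $f(n)$ comparisons; it has work $w(n)$ if it performs at most $w(n)$ comparisons in total. *)

theory Defs
  imports Complex_Main
begin

text \<open>
  A deterministic comparison-based algorithm on inputs of a fixed size is a finite decision tree.
  Its nodes name positions of the input list, which play the role of the input elements (so equal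
  values at different positions are different elements). A node \<open>Compare i j l r\<close> asks whether
  the element at \<open>i\<close> is at most the element at \<open>j\<close>, continuing with \<open>l\<close> if so and with \<open>r\<close>
  otherwise. On pairwise distinct elements a three-way comparison gives no further information.
\<close>

datatype comp_alg = Output nat | Compare nat nat comp_alg comp_alg

primrec accesses_below :: "nat \<Rightarrow> comp_alg \<Rightarrow> bool" where
  "accesses_below n (Output i) \<longleftrightarrow> i < n"
| "accesses_below n (Compare i j l r) \<longleftrightarrow>
     i < n \<and> j < n \<and> accesses_below n l \<and> accesses_below n r"

primrec result :: "comp_alg \<Rightarrow> 'a::linorder list \<Rightarrow> nat" where
  "result (Output i) xs = i"
| "result (Compare i j l r) xs = (if xs ! i \<le> xs ! j then result l xs else result r xs)"

primrec comparisons :: "comp_alg \<Rightarrow> 'a::linorder list \<Rightarrow> (nat \<times> nat) list" where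
  "comparisons (Output i) xs = []"
| "comparisons (Compare i j l r) xs =
     (i, j) # (if xs ! i \<le> xs ! j then comparisons l xs else comparisons r xs)"

definition participations :: "comp_alg \<Rightarrow> 'a::linorder list \<Rightarrow> nat \<Rightarrow> nat" where
  "participations t xs k = length (filter (\<lambda>(i, j). k = i \<or> k = j) (comparisons t xs))"

definition inputs :: "nat \<Rightarrow> 'a list set" where
  "inputs n = {xs. length xs = n}"

definition distinct_inputs :: "nat \<Rightarrow> 'a list set" where
  "distinct_inputs n = {xs. length xs = n \<and> distinct xs}"

text \<open>
  The set \<open>distinct_inputs n\<close> is empty when \<open>'a\<close> has fewer than \<open>n\<close> elements; lower bounds have to
  exclude this case (over \<open>unit\<close>, no comparison is ever needed).

  In the following, \<open>D\<close> is the class of admissible inputs of size \<open>n\<close>: either all of them, with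
  ties allowed, or only those with pairwise distinct elements.
\<close>

definition is_minimum :: "'a::linorder list \<Rightarrow> nat \<Rightarrow> bool" where
  "is_minimum xs k \<longleftrightarrow> k < length xs \<and> xs ! k = Min (set xs)"

definition finds_minimum :: "nat \<Rightarrow> 'a::linorder list set \<Rightarrow> comp_alg \<Rightarrow> bool" where
  "finds_minimum n D t \<longleftrightarrow> accesses_below n t \<and> (\<forall>xs\<in>D. is_minimum xs (result t xs))"

definition has_fragile_complexity :: "nat \<Rightarrow> 'a::linorder list set \<Rightarrow> comp_alg \<Rightarrow> nat \<Rightarrow> bool" where
  "has_fragile_complexity n D t f \<longleftrightarrow> (\<forall>xs\<in>D. \<forall>k<n. participations t xs k \<le> f)"

definition min_fragile_complexity :: "nat \<Rightarrow> 'a::linorder list set \<Rightarrow> nat" where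
  "min_fragile_complexity n D =
     (LEAST f. \<exists>t. finds_minimum n D t \<and> has_fragile_complexity n D t f)"

end

theory Submission
  imports Defs "HOL-Library.Multiset"
begin

text \<open>
  A balanced knockout tournament gives the upper bound. For the lower bound, an adversary keeps a
  set of candidates, the elements that have not lost yet, each with a weight; initially all weights
  are 1. Losers have fixed values above those of all candidates. When two candidates meet, the
  lighter one loses, gets the largest value that is still free, and hands its weight to the winner.
  The total weight stays \<open>n\<close>, a weight at most doubles when its owner is compared, and a correct
  algorithm can only stop with one candidate, which then carries weight \<open>n\<close>.
\<close>

section \<open>Tournaments\<close>

text \<open>Monadic bind of decision trees: the comparisons made later may depend on the position
  output earlier.\<close>

primrec bind_alg :: "comp_alg \<Rightarrow> (nat \<Rightarrow> comp_alg) \<Rightarrow> comp_alg" where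
  "bind_alg (Output i) f = f i"
| "bind_alg (Compare i j l r) f = Compare i j (bind_alg l f) (bind_alg r f)"

lemma result_bind_alg [simp]: "result (bind_alg t f) xs = result (f (result t xs)) xs"
  by (induction t) auto

lemma comparisons_bind_alg [simp]:
  "comparisons (bind_alg t f) xs = comparisons t xs @ comparisons (f (result t xs)) xs"
  by (induction t) auto

lemma participations_Output [simp]: "participations (Output i) xs k = 0"
  by (simp add: participations_def)

lemma participations_Compare:
  "participations (Compare i j l r) xs k =
     (if k = i \<or> k = j then 1 else 0) +
     (if xs ! i \<le> xs ! j then participations l xs k else participations r xs k)"
  by (simp add: participations_def)

lemma participations_bind_alg [simp]:
  "participations (bind_alg t f) xs k =
     participations t xs k + participations (f (result t xs)) xs k"
  by (simp add: participations_def)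

text \<open>
  The minimum among the positions \<open>a..<b\<close>; only meaningful for \<open>a < b \<le> a + 2 ^ d\<close>.
\<close>

primrec tournament :: "nat \<Rightarrow> nat \<Rightarrow> nat \<Rightarrow> comp_alg" where
  "tournament 0 a b = Output a"
| "tournament (Suc d) a b =
     (if b \<le> a + 2 ^ d then tournament d a b
      else bind_alg (tournament d a (a + 2 ^ d)) (\<lambda>i.
           bind_alg (tournament d (a + 2 ^ d) b) (\<lambda>j. Compare i j (Output i) (Output j))))"

lemma accesses_below_bind_alg:
  assumes "accesses_below n t" and "\<And>i. i < n \<Longrightarrow> accesses_below n (f i)"
  shows "accesses_below n (bind_alg t f)"
  using assms by (induction t) auto

lemma accesses_below_tournament:
  assumes "a < b" and "b \<le> n"
  shows "accesses_below n (tournament d a b)"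
  using assms by (induction d arbitrary: a b) (auto intro!: accesses_below_bind_alg)

lemma tournament_result:
  assumes "a < b" and "b \<le> a + 2 ^ d"
  shows "result (tournament d a b) xs \<in> {a..<b} \<and>
         (\<forall>k\<in>{a..<b}. xs ! result (tournament d a b) xs \<le> xs ! k)"
  using assms
proof (induction d arbitrary: a b)
  case 0
  then have "b = Suc a" by simp
  then show ?case by simp
next
  case (Suc d)
  show ?case
  proof (cases "b \<le> a + 2 ^ d")
    case True
    with Suc show ?thesis by simp
  next
    case False
    \<comment> \<open>The left part is full, with exactly \<open>2 ^ d\<close> positions; the right
      part is nonempty because the test for skipping a round failed.\<close>
    define m where "m = a + 2 ^ d"
    have m: "a < m" "m < b" using False by (auto simp: m_def)
    define i where "i = result (tournament d a m) xs"
    define j where "j = result (tournament d m b) xs"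
    have i: "i \<in> {a..<m}" "\<And>k. k \<in> {a..<m} \<Longrightarrow> xs ! i \<le> xs ! k"
      using Suc.IH[of a m] m by (auto simp: i_def m_def)
    have j: "j \<in> {m..<b}" "\<And>k. k \<in> {m..<b} \<Longrightarrow> xs ! j \<le> xs ! k"
      using Suc.IH[of m b] m Suc.prems by (auto simp: j_def m_def)
    have res: "result (tournament (Suc d) a b) xs = (if xs ! i \<le> xs ! j then i else j)"
      using False by (simp add: i_def j_def m_def)
    have "xs ! (if xs ! i \<le> xs ! j then i else j) \<le> xs ! k" if "k \<in> {a..<b}" for k
    proof (cases "k < m")
      case True
      then have "xs ! i \<le> xs ! k" using i(2) that by simp
      then show ?thesis by auto
    next
      case False
      then have "xs ! j \<le> xs ! k" using j(2) that by simp
      then show ?thesis by auto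
    qed
    then show ?thesis using res i(1) j(1) m by auto
  qed
qed

text \<open>The two halves are disjoint, so an element is compared in at most one of them, and once
  more if it wins there. The bound 0 outside the range makes this induction work.\<close>

lemma participations_tournament_le:
  assumes "a < b" and "b \<le> a + 2 ^ d"
  shows "participations (tournament d a b) xs k \<le> (if k \<in> {a..<b} then d else 0)"
  using assms
proof (induction d arbitrary: a b)
  case (Suc d)
  show ?case
  proof (cases "b \<le> a + 2 ^ d")
    case True
    then show ?thesis using Suc.IH[OF Suc.prems(1) True] by auto
  next
    case False
    define m where "m = a + 2 ^ d"
    have m: "a < m" "m < b" "m \<le> a + 2 ^ d" "b \<le> m + 2 ^ d"
      using False Suc.prems by (auto simp: m_def)
    have "result (tournament d a m) xs \<in> {a..<m}" "result (tournament d m b) xs \<in> {m..<b}"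
      using tournament_result[OF m(1,3), of xs] tournament_result[OF m(2,4), of xs] by auto
    moreover note Suc.IH[OF m(1,3)] Suc.IH[OF m(2,4)]
    moreover have "participations (tournament (Suc d) a b) xs k =
        participations (tournament d a m) xs k + participations (tournament d m b) xs k +
        (if k = result (tournament d a m) xs \<or> k = result (tournament d m b) xs then 1 else 0)"
      using False by (simp add: m_def participations_Compare)
    ultimately show ?thesis using m by (auto split: if_splits)
  qed
qed simp

lemma is_minimum_iff:
  "is_minimum xs k \<longleftrightarrow> k < length xs \<and> (\<forall>j<length xs. xs ! k \<le> xs ! j)"
proof -
  have "xs ! k = Min (set xs) \<longleftrightarrow> (\<forall>j<length xs. xs ! k \<le> xs ! j)" if "k < length xs"
  proof -
    have "set xs \<noteq> {}" "xs ! k \<in> set xs" using that by auto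
    then show ?thesis by (simp add: eq_Min_iff all_set_conv_all_nth)
  qed
  then show ?thesis unfolding is_minimum_def by blast
qed

lemma finds_minimum_tournament:
  assumes "1 \<le> n" and "n \<le> 2 ^ d"
  shows "finds_minimum n (inputs n) (tournament d 0 n)"
  unfolding finds_minimum_def
proof (intro conjI ballI)
  show "accesses_below n (tournament d 0 n)"
    using assms by (intro accesses_below_tournament) auto
next
  fix xs :: "'a list"
  assume "xs \<in> inputs n"
  then show "is_minimum xs (result (tournament d 0 n) xs)"
    using assms tournament_result[of 0 n d xs] by (simp add: is_minimum_iff inputs_def)
qed

lemma has_fragile_complexity_tournament:
  assumes "1 \<le> n" and "n \<le> 2 ^ d"
  shows "has_fragile_complexity n (inputs n) (tournament d 0 n) d"
  unfolding has_fragile_complexity_def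
proof (intro ballI allI impI)
  fix xs :: "'a list" and k
  assume "k < n"
  then show "participations (tournament d 0 n) xs k \<le> d"
    using participations_tournament_le[of 0 n d xs k] assms by simp
qed

section \<open>The adversary\<close>

text \<open>
  The state of the adversary is an input \<open>xs\<close> together with the set \<open>C\<close> of candidates; the inputs
  still admitted are \<open>rearrangements xs C\<close>.
\<close>

definition rearrangements :: "'a list \<Rightarrow> nat set \<Rightarrow> 'a list set" where
  "rearrangements xs C =
     {ys. mset ys = mset xs \<and> (\<forall>k<length xs. k \<notin> C \<longrightarrow> ys ! k = xs ! k)}"

definition lowest :: "'a::linorder list \<Rightarrow> nat set \<Rightarrow> bool" where
  "lowest xs C \<longleftrightarrow> (\<forall>c\<in>C. \<forall>k<length xs. k \<notin> C \<longrightarrow> xs ! c < xs ! k)"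

lemma rearrangements_refl: "xs \<in> rearrangements xs C"
  by (simp add: rearrangements_def)

lemma rearrangements_length: "ys \<in> rearrangements xs C \<Longrightarrow> length ys = length xs"
  using mset_eq_length[of ys xs] by (simp add: rearrangements_def)

lemma rearrangements_distinct: "ys \<in> rearrangements xs C \<Longrightarrow> distinct xs \<Longrightarrow> distinct ys"
  using mset_eq_imp_distinct_iff[of ys xs] by (simp add: rearrangements_def)

lemma rearrangements_trans:
  assumes "ys \<in> rearrangements xs C" and "zs \<in> rearrangements ys C'" and "C' \<subseteq> C"
  shows "zs \<in> rearrangements xs C"
  using assms rearrangements_length[OF assms(1)] by (auto simp: rearrangements_def)

lemma rearrangements_swap:
  assumes "a \<in> C" and "b \<in> C" and "C \<subseteq> {..<length xs}"
  shows "xs[a := xs ! b, b := xs ! a] \<in> rearrangements xs C"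
proof -
  have "a < length xs" "b < length xs" using assms by auto
  then show ?thesis using assms by (auto simp: rearrangements_def mset_swap nth_list_update)
qed

text \<open>Positions outside \<open>C\<close> keep their values, so by distinctness the values
  inside \<open>C\<close> are only permuted among themselves.\<close>

lemma lowest_rearrangements:
  assumes ys: "ys \<in> rearrangements xs C" and low: "lowest xs C" and xs: "distinct xs"
    and C: "C \<subseteq> {..<length xs}"
  shows "lowest ys C"
  unfolding lowest_def
proof (intro ballI allI impI)
  fix c k
  assume c: "c \<in> C" and k: "k < length ys" "k \<notin> C"
  have len: "length ys = length xs" and dist: "distinct ys"
    using rearrangements_length[OF ys] rearrangements_distinct[OF ys xs] by auto
  have "set ys = set xs" using ys mset_eq_setD[of ys xs] by (simp add: rearrangements_def)
  moreover have "ys ! c \<in> set ys" using c C len by auto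
  ultimately obtain c' where c': "c' < length xs" "ys ! c = xs ! c'"
    by (auto simp: in_set_conv_nth)
  have "c' \<in> C"
  proof (rule ccontr)
    assume "c' \<notin> C"
    then have "ys ! c' = ys ! c" using ys c' by (simp add: rearrangements_def)
    moreover have "c < length ys" using c C len by auto
    ultimately have "c' = c" using nth_eq_iff_index_eq[OF dist, of c' c] c' len by simp
    with c \<open>c' \<notin> C\<close> show False by simp
  qed
  moreover have "ys ! k = xs ! k" using ys k len by (simp add: rearrangements_def)
  ultimately show "ys ! c < ys ! k" using low k len c' by (auto simp: lowest_def)
qed

lemma lowest_candidates_singleton:
  assumes "distinct xs" and C: "C \<subseteq> {..<length xs}" "C \<noteq> {}" and low: "lowest xs C"
    and min: "\<And>ys. ys \<in> rearrangements xs C \<Longrightarrow> is_minimum ys k"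
  shows "C = {k}"
proof -
  have k: "k < length xs" "\<And>j. j < length xs \<Longrightarrow> xs ! k \<le> xs ! j"
    using min[OF rearrangements_refl] by (auto simp: is_minimum_iff)
  have kC: "k \<in> C"
  proof (rule ccontr)
    assume "k \<notin> C"
    obtain c where "c \<in> C" using C by auto
    then have "xs ! c < xs ! k" using low k \<open>k \<notin> C\<close> by (auto simp: lowest_def)
    moreover have "xs ! k \<le> xs ! c" using k C \<open>c \<in> C\<close> by auto
    ultimately show False by simp
  qed
  have "c = k" if c: "c \<in> C" for c
  proof (rule ccontr)
    assume "c \<noteq> k"
    have cl: "c < length xs" using c C by auto
    have "is_minimum (xs[c := xs ! k, k := xs ! c]) k"
      by (rule min[OF rearrangements_swap[OF c kC C(1)]])
    then have "xs[c := xs ! k, k := xs ! c] ! k \<le> xs[c := xs ! k, k := xs ! c] ! c"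
      using cl by (simp only: is_minimum_iff length_list_update)
    then have "xs ! c = xs ! k" using k(2)[OF cl] k(1) cl \<open>c \<noteq> k\<close> by simp
    then show False using nth_eq_iff_index_eq[OF assms(1) cl k(1)] \<open>c \<noteq> k\<close> by simp
  qed
  with kC show ?thesis by blast
qed

text \<open>Swapping the largest candidate value onto \<open>b\<close> makes \<open>b\<close> a
  loser. No fresh values are taken, so any linear order works, even a finite one.\<close>

lemma lowest_remove_candidate:
  assumes xs: "distinct xs" and C: "C \<subseteq> {..<length xs}" and b: "b \<in> C" and low: "lowest xs C"
  obtains ys where "ys \<in> rearrangements xs C" and "lowest ys (C - {b})"
proof -
  have fin: "finite C" using C finite_subset by blast
  define M where "M = Max ((!) xs ` C)"
  have "M \<in> (!) xs ` C" unfolding M_def using fin b by (intro Max_in) auto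
  then obtain m where m: "m \<in> C" "xs ! m = M" by auto
  have le: "xs ! c \<le> M" if "c \<in> C" for c unfolding M_def using fin that by simp
  \<comment> \<open>If \<open>b\<close> already holds the largest value, then \<open>m = b\<close>
    and the update changes nothing.\<close>
  define ys where "ys = xs[b := xs ! m, m := xs ! b]"
  have ys: "ys \<in> rearrangements xs C"
    unfolding ys_def by (rule rearrangements_swap[OF b m(1) C])
  have bm: "b < length xs" "m < length xs" using b m C by auto
  have dist: "distinct ys" and len: "length ys = length xs"
    using rearrangements_distinct[OF ys xs] rearrangements_length[OF ys] by auto
  have ysb: "ys ! b = M" unfolding ys_def using bm m(2) by (auto simp: nth_list_update)
  have "lowest ys C" by (rule lowest_rearrangements[OF ys low xs C])
  moreover have "ys ! c < ys ! b" if c: "c \<in> C - {b}" for c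
  proof -
    have cl: "c < length xs" using c C by auto
    have "ys ! c \<le> M"
      unfolding ys_def using c cl bm le b by (auto simp: nth_list_update)
    moreover have "ys ! c \<noteq> ys ! b"
      using dist c cl bm len by (simp add: nth_eq_iff_index_eq)
    ultimately show ?thesis using ysb by simp
  qed
  ultimately have "lowest ys (C - {b})" by (auto simp: lowest_def)
  with ys that show ?thesis by blast
qed

text \<open>Losers have fixed values and candidates lie below them, so only a comparison of two
  different candidates leaves the adversary a choice.\<close>

lemma lowest_forced_comparison:
  assumes "distinct xs" and "C \<subseteq> {..<length xs}" and "lowest xs C"
    and "i < length xs" and "j < length xs" and "i = j \<or> i \<notin> C \<or> j \<notin> C"
    and ys: "ys \<in> rearrangements xs C"
  shows "ys ! i \<le> ys ! j \<longleftrightarrow> xs ! i \<le> xs ! j"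
proof -
  have low: "lowest ys C" using lowest_rearrangements[OF ys assms(3,1,2)] .
  have len: "length ys = length xs" using rearrangements_length[OF ys] .
  have eq: "ys ! k = xs ! k" if "k < length xs" "k \<notin> C" for k
    using ys that by (simp add: rearrangements_def)
  have less: "xs ! c < xs ! k" "ys ! c < ys ! k" if "c \<in> C" "k < length xs" "k \<notin> C" for c k
    using that low assms(3) len by (auto simp: lowest_def)
  consider "i = j" | "i \<in> C" "j \<notin> C" | "i \<notin> C" "j \<in> C" | "i \<notin> C" "j \<notin> C"
    using assms(6) by blast
  then show ?thesis
  proof cases
    case 2
    then show ?thesis using less[OF 2(1) assms(5) 2(2)] by (simp add: less_imp_le)
  next
    case 3
    then show ?thesis using less[OF 3(2) assms(4) 3(1)] by (simp add: not_le [symmetric])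
  qed (use eq assms(4,5) in simp_all)
qed

text \<open>Each comparison of the final winner at most doubles its weight, which ends as the total
  weight of \<open>C\<close>; hence the factor \<open>2 ^ participations\<close>. The weights
  \<open>w\<close> are arbitrary because the induction changes them.\<close>

lemma adversary:
  fixes xs :: "'a::linorder list" and w :: "nat \<Rightarrow> nat"
  assumes "distinct xs" and "C \<subseteq> {..<length xs}" and "C \<noteq> {}" and "lowest xs C"
    and "accesses_below (length xs) t"
    and "\<And>ys. ys \<in> rearrangements xs C \<Longrightarrow> is_minimum ys (result t ys)"
  shows "\<exists>ys \<in> rearrangements xs C.
           sum w C \<le> w (result t ys) * 2 ^ participations t ys (result t ys)"
  using assms
proof (induction t arbitrary: xs C w)
  case (Output k)
  have "C = {k}"
    using Output.prems by (intro lowest_candidates_singleton[of xs]) auto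
  then show ?case by (auto intro!: bexI[of _ xs] rearrangements_refl)
next
  case (Compare i j l r)
  note xs = Compare.prems(1) and C = Compare.prems(2) and low = Compare.prems(4)
  have ij: "i < length xs" "j < length xs"
    and acc: "accesses_below (length xs) l" "accesses_below (length xs) r"
    using Compare.prems(5) by auto
  let ?t = "Compare i j l r"
  have fin: "finite C" using C finite_subset by blast
  \<comment> \<open>Both induction hypotheses in one form, so that the subtree can be picked by the
    adversary's answer.\<close>
  have IH: "\<exists>ys \<in> rearrangements zs D.
              sum v D \<le> v (result s ys) * 2 ^ participations s ys (result s ys)"
    if "s = l \<or> s = r" "distinct zs" "D \<subseteq> {..<length zs}" "D \<noteq> {}" "lowest zs D"
      "length zs = length xs" "\<And>ys. ys \<in> rearrangements zs D \<Longrightarrow> is_minimum ys (result s ys)"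
    for s and zs :: "'a list" and D and v :: "nat \<Rightarrow> nat"
    using that(1)
  proof
    assume s: "s = l"
    have "accesses_below (length zs) l" using acc that(6) by simp
    then show ?thesis
      unfolding s by (rule Compare.IH(1)[OF that(2-5)]) (rule that(7)[unfolded s])
  next
    assume s: "s = r"
    have "accesses_below (length zs) r" using acc that(6) by simp
    then show ?thesis
      unfolding s by (rule Compare.IH(2)[OF that(2-5)]) (rule that(7)[unfolded s])
  qed
  show ?case
  proof (cases "i = j \<or> i \<notin> C \<or> j \<notin> C")
    case True
    \<comment> \<open>The answer is forced: candidates and weights stay, and the extra participation
      only weakens the bound to be shown.\<close>
    define s where "s = (if xs ! i \<le> xs ! j then l else r)"
    have res: "result ?t ys = result s ys"
      and part: "participations s ys k \<le> participations ?t ys k"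
      if "ys \<in> rearrangements xs C" for ys k
      using lowest_forced_comparison[OF xs C low ij True that]
      by (auto simp: s_def participations_Compare)
    have "s = l \<or> s = r" by (simp add: s_def)
    moreover have "is_minimum ys (result s ys)" if "ys \<in> rearrangements xs C" for ys
      using Compare.prems(6)[OF that] by (simp only: res[OF that])
    ultimately obtain ys where ys: "ys \<in> rearrangements xs C"
      and le: "sum w C \<le> w (result s ys) * 2 ^ participations s ys (result s ys)"
      using IH[OF _ xs C Compare.prems(3) low refl, of s w] by blast
    note le
    also have "w (result s ys) * 2 ^ participations s ys (result s ys)
               \<le> w (result s ys) * 2 ^ participations ?t ys (result s ys)"
      using part[OF ys] by (intro mult_left_mono power_increasing) auto
    finally show ?thesis by (intro bexI[OF _ ys]) (simp only: res[OF ys])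
  next
    case False
    \<comment> \<open>The heavier candidate \<open>a\<close> is to win, so that
      \<open>w a + w b \<le> 2 * w a\<close>.\<close>
    then obtain a b where ab: "(a, b) = (i, j) \<or> (a, b) = (j, i)" "w b \<le> w a"
      using linear[of "w i" "w j"] by blast
    have abC: "a \<in> C" "b \<in> C" "a \<noteq> b" using ab False by auto
    obtain xs' where xs': "xs' \<in> rearrangements xs C" and low': "lowest xs' (C - {b})"
      using lowest_remove_candidate[OF xs C abC(2) low] .
    have len': "length xs' = length xs" and dist': "distinct xs'"
      using rearrangements_length[OF xs'] rearrangements_distinct[OF xs' xs] by auto
    have C': "C - {b} \<subseteq> {..<length xs'}" "C - {b} \<noteq> {}" using C abC len' by auto
    define s where "s = (if a = i then l else r)"
    \<comment> \<open>\<open>b\<close> leaves the candidates, so its unchanged entry in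
      \<open>w'\<close> is not counted again and the total weight is preserved.\<close>
    define w' where "w' = w(a := w a + w b)"
    have sub: "ys \<in> rearrangements xs C" if "ys \<in> rearrangements xs' (C - {b})" for ys
      using rearrangements_trans[OF xs' that] by blast
    have res: "result ?t ys = result s ys"
      and part: "participations ?t ys k =
                   (if k = a \<or> k = b then 1 else 0) + participations s ys k"
      if "ys \<in> rearrangements xs' (C - {b})" for ys k
    proof -
      have "lowest ys (C - {b})"
        using lowest_rearrangements[OF that low' dist' C'(1)] .
      moreover have "b < length ys" using abC C rearrangements_length[OF sub[OF that]] by auto
      ultimately have "ys ! a < ys ! b" using abC by (auto simp: lowest_def)
      then show "result ?t ys = result s ys"
        "participations ?t ys k = (if k = a \<or> k = b then 1 else 0) + participations s ys k"
        using ab(1) abC(3) by (auto simp: s_def participations_Compare)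
    qed
    have "s = l \<or> s = r" by (simp add: s_def)
    moreover have "is_minimum ys (result s ys)"
      if "ys \<in> rearrangements xs' (C - {b})" for ys
      using Compare.prems(6)[OF sub[OF that]] by (simp only: res[OF that])
    ultimately obtain ys where ys: "ys \<in> rearrangements xs' (C - {b})"
      and le: "sum w' (C - {b})
                 \<le> w' (result s ys) * 2 ^ participations s ys (result s ys)"
      using IH[OF _ dist' C' low' len', of s w'] by blast
    have "sum w C = w a + w b + sum w (C - {b} - {a})"
      using fin abC by (simp add: sum.remove[of C b] sum.remove[of "C - {b}" a])
    also have "\<dots> = sum w' (C - {b})"
      using fin abC by (simp add: sum.remove[of "C - {b}" a] w'_def)
    also note le
    also have "w' (result s ys) * 2 ^ participations s ys (result s ys)
               \<le> w (result s ys) * 2 ^ participations ?t ys (result s ys)"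
    proof (cases "result s ys = a")
      \<comment> \<open>The participation of \<open>a\<close> in this comparison supplies the factor
        2 that pays for the inherited weight.\<close>
      case True
      have "w' a * 2 ^ participations s ys a \<le> (2 * w a) * 2 ^ participations s ys a"
        using ab(2) by (intro mult_right_mono) (auto simp: w'_def)
      also have "\<dots> = w a * 2 ^ participations ?t ys a" using part[OF ys] by simp
      finally show ?thesis using True by simp
    next
      case False
      then show ?thesis
        using part[OF ys] by (auto simp: w'_def intro!: mult_left_mono power_increasing)
    qed
    finally show ?thesis by (intro bexI[OF _ sub[OF ys]]) (simp only: res[OF ys])
  qed
qed

section \<open>The fragile complexity of the minimum\<close>

text \<open>The adversary starts with every position a candidate of weight 1: the invariant is
  vacuous and the total weight is \<open>n\<close>.\<close>

lemma finds_minimum_participations_lower_bound: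
  fixes t :: comp_alg
  assumes "1 \<le> n" and "distinct_inputs n \<noteq> ({} :: 'a::linorder list set)"
    and t: "finds_minimum n (distinct_inputs n :: 'a::linorder list set) t"
  obtains xs :: "'a::linorder list" and k where "xs \<in> distinct_inputs n" and "is_minimum xs k"
    and "n \<le> 2 ^ participations t xs k"
proof -
  obtain xs :: "'a list" where xs: "length xs = n" "distinct xs"
    using assms(2) by (auto simp: distinct_inputs_def)
  have dist: "ys \<in> distinct_inputs n" if "ys \<in> rearrangements xs {..<n}" for ys
    using rearrangements_length[OF that] rearrangements_distinct[OF that] xs
    by (simp add: distinct_inputs_def)
  have "\<exists>ys \<in> rearrangements xs {..<n}.
          sum (\<lambda>_. 1) {..<n} \<le> (1::nat) * 2 ^ participations t ys (result t ys)"
    using t dist assms(1) xs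
    by (intro adversary) (auto simp: finds_minimum_def lowest_def lessThan_empty_iff)
  then obtain ys where ys: "ys \<in> rearrangements xs {..<n}"
    and le: "n \<le> 2 ^ participations t ys (result t ys)" by auto
  have "is_minimum ys (result t ys)" using t dist[OF ys] by (simp add: finds_minimum_def)
  with dist[OF ys] le that show thesis by blast
qed

text \<open>Serves both bounds: at \<open>p\<close> equal to the ceiling it shows that the
  tournament has enough rounds, and at a participation count it turns the adversary's bound into a
  logarithm.\<close>

lemma nat_ceiling_log2_le_iff:
  assumes "1 \<le> n"
  shows "nat \<lceil>log 2 (real n)\<rceil> \<le> p \<longleftrightarrow> n \<le> 2 ^ p"
proof -
  have "nat \<lceil>log 2 (real n)\<rceil> \<le> p \<longleftrightarrow> log 2 (real n) \<le> real p"
    by (simp add: nat_le_iff ceiling_le_iff)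
  also have "\<dots> \<longleftrightarrow> real n \<le> 2 ^ p"
    using assms by (simp add: log_le_iff powr_realpow)
  also have "\<dots> \<longleftrightarrow> n \<le> 2 ^ p"
    by (metis of_nat_le_iff of_nat_numeral of_nat_power)
  finally show ?thesis .
qed

theorem theorem2:
  fixes n :: nat
  assumes "n \<ge> 1"
  shows
    "(\<exists>t. finds_minimum n (inputs n :: 'a::linorder list set) t \<and>
          has_fragile_complexity n (inputs n :: 'a list set) t (nat \<lceil>log 2 (real n)\<rceil>)) \<and>
     ((distinct_inputs n :: 'a list set) \<noteq> {} \<longrightarrow>
       (\<forall>t. finds_minimum n (distinct_inputs n :: 'a list set) t \<longrightarrow>
         (\<exists>xs \<in> (distinct_inputs n :: 'a list set). \<exists>k. is_minimum xs k \<and>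
            participations t xs k \<ge> nat \<lceil>log 2 (real n)\<rceil>)) \<and>
       min_fragile_complexity n (inputs n :: 'a list set) = nat \<lceil>log 2 (real n)\<rceil> \<and>
       min_fragile_complexity n (distinct_inputs n :: 'a list set) = nat \<lceil>log 2 (real n)\<rceil>)"
proof -
  let ?f = "nat \<lceil>log 2 (real n)\<rceil>"
  let ?I = "inputs n :: 'a list set" and ?D = "distinct_inputs n :: 'a list set"
  let ?t = "tournament ?f 0 n"
  have "n \<le> 2 ^ ?f" using nat_ceiling_log2_le_iff[OF assms] by blast
  then have upper: "finds_minimum n ?I ?t" "has_fragile_complexity n ?I ?t ?f"
    using finds_minimum_tournament has_fragile_complexity_tournament assms by auto
  have sub: "?D \<subseteq> ?I" by (auto simp: inputs_def distinct_inputs_def)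
  have lower: "\<exists>xs \<in> ?D. \<exists>k. is_minimum xs k \<and> ?f \<le> participations t xs k"
    if "?D \<noteq> {}" "finds_minimum n ?D t" for t
    using finds_minimum_participations_lower_bound[OF assms that]
      nat_ceiling_log2_le_iff[OF assms] by metis
  \<comment> \<open>One argument for both input classes: the tournament's guarantees restrict from
    \<open>?I\<close> to \<open>A\<close>, and an algorithm for \<open>A\<close> also solves
    \<open>?D\<close>, where the lower bound applies.\<close>
  have "min_fragile_complexity n A = ?f"
    if ne: "?D \<noteq> {}" and DA: "?D \<subseteq> A" and AI: "A \<subseteq> ?I" for A
    unfolding min_fragile_complexity_def
  proof (rule Least_equality)
    show "\<exists>t. finds_minimum n A t \<and> has_fragile_complexity n A t ?f"
      using upper AI
      by (auto simp: finds_minimum_def has_fragile_complexity_def intro!: exI[of _ ?t])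
  next
    fix f
    assume "\<exists>t. finds_minimum n A t \<and> has_fragile_complexity n A t f"
    then obtain t where t: "finds_minimum n A t" "has_fragile_complexity n A t f" by blast
    have "finds_minimum n ?D t" using t(1) DA by (auto simp: finds_minimum_def)
    then obtain xs k where "xs \<in> ?D" "is_minimum xs k" "?f \<le> participations t xs k"
      using lower[OF ne] by blast
    moreover from this have "participations t xs k \<le> f"
      using t(2) DA
      by (auto simp: has_fragile_complexity_def is_minimum_def distinct_inputs_def)
    ultimately show "?f \<le> f" by simp
  qed
  then show ?thesis using upper lower sub by blast
qed

end
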